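(* Let $\sigma=[P_0P_1P_2]$ and $\tau=[A_0A_1A_2]$ be 2-dimensional simplices (non-degenerate triangles) in $\mathbb{R}^2$ with $\sigma\subset\tau$, such that the three vertices of $\sigma$ are contained in the relative interiors of three different sides of $\tau$. Then $\sigma$ can be moved by congruence within $\tau$ a little; that is, there exists a movement of $\sigma$ within $\tau$ by $E^+(2)$.
   Context: $[P_0P_1P_2]$ denotes the closed triangle with the given vertices. $E^+(n)$ denotes the group of orientation preserving congruences (isometries) of $\mathbb{R}^n$. A movement of $\sigma$ within $\tau$ by $E^+(n)$ is a smooth non-trivial (i.e. non-constant) curve $C:[0,\epsilon)\to E^+(n)$, for some $\epsilon>0$, such that $C(0)$ is the identity and $C(t)(\sigma)\subset\tau$ for all $t\in(0,\epsilon)$. $C$ need not be part of a one-parameter subgroup. *)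

theory Defs
  imports "HOL-Analysis.Analysis"
begin

definition linear_part :: "(real^'n \<Rightarrow> real^'n) \<Rightarrow> real^'n^'n" where
  "linear_part f = matrix (\<lambda>x. f x - f 0)"

text \<open>
  The group \<open>E\<^sup>+(n)\<close>. An isometry of Euclidean space is affine, so its linear part is an orthogonal
  matrix, and it preserves orientation iff the determinant of that matrix is positive.
\<close>

definition direct_isometries :: "(real^'n \<Rightarrow> real^'n) set" where
  "direct_isometries = {f. (\<forall>x y. dist (f x) (f y) = dist x y) \<and> det (linear_part f) > 0}"

lemma linear_part_affine [simp]: "linear_part (\<lambda>x. A *v x + b) = A"
  by (simp add: linear_part_def)

lemma direct_isometries_eq:
  "(direct_isometries :: (real^'n \<Rightarrow> real^'n) set) = {\<lambda>x. A *v x + b | A b. rotation_matrix A}"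
proof (intro set_eqI iffI)
  fix f :: "real^'n \<Rightarrow> real^'n"
  assume "f \<in> direct_isometries"
  then have iso: "\<And>x y. dist (f x) (f y) = dist x y" and pos: "det (linear_part f) > 0"
    by (auto simp: direct_isometries_def)
  define g where "g = (\<lambda>x. f x - f 0)"
  have "orthogonal_transformation g"
    unfolding orthogonal_transformation_isometry using iso by (simp add: g_def dist_norm)
  then have lin: "linear g" and orth: "orthogonal_matrix (matrix g)"
    by (auto simp: orthogonal_transformation_matrix)
  have "rotation_matrix (matrix g)"
    using det_orthogonal_matrix[OF orth] orth pos
    by (auto simp: rotation_matrix_def linear_part_def g_def)
  moreover have "f = (\<lambda>x. matrix g *v x + f 0)"
  proof
    fix x
    have "matrix g *v x = g x" by (rule fun_cong[OF matrix_vector_mul(2)[OF lin]])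
    then show "f x = matrix g *v x + f 0" by (simp add: g_def)
  qed
  ultimately show "f \<in> {\<lambda>x. A *v x + b | A b. rotation_matrix A}" by blast
next
  fix f :: "real^'n \<Rightarrow> real^'n"
  assume "f \<in> {\<lambda>x. A *v x + b | A b. rotation_matrix A}"
  then obtain A b where f: "f = (\<lambda>x. A *v x + b)" and A: "rotation_matrix A" by blast
  have "orthogonal_transformation ((*v) A)"
    using A by (simp add: orthogonal_transformation_matrix rotation_matrix_def)
  then have "dist (f x) (f y) = dist x y" for x y
    by (simp add: f orthogonal_transformation_isometry)
  then show "f \<in> direct_isometries"
    using A unfolding direct_isometries_def by (auto simp: f rotation_matrix_def)
qed

text \<open>
  \<open>C\<^sup>\<infinity>\<close> on \<open>I\<close>, where \<open>I\<close> is meant to be a nondegenerate interval; \<open>D k\<close> is the \<open>k\<close>-th derivative.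
  At an endpoint belonging to \<open>I\<close> the derivatives are one-sided.
\<close>

definition smooth_curve_on :: "real set \<Rightarrow> (real \<Rightarrow> 'a::real_normed_vector) \<Rightarrow> bool" where
  "smooth_curve_on I f \<longleftrightarrow>
    (\<exists>D :: nat \<Rightarrow> real \<Rightarrow> 'a. (\<forall>t\<in>I. D 0 t = f t) \<and>
       (\<forall>k. \<forall>t\<in>I. (D k has_vector_derivative D (Suc k) t) (at t within I)))"

text \<open>
  Smoothness in \<open>E\<^sup>+(n)\<close> refers to its Lie group structure as \<open>SO(n) \<times> \<real>\<^sup>n\<close>: the motion
  \<open>x \<mapsto> A x + b\<close> has coordinates \<open>(A, b)\<close>.
\<close>

definition movement ::
  "real \<Rightarrow> (real \<Rightarrow> real^'n \<Rightarrow> real^'n) \<Rightarrow> (real^'n) set \<Rightarrow> (real^'n) set \<Rightarrow> bool" where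
  "movement \<epsilon> C \<sigma> \<tau> \<longleftrightarrow>
     \<epsilon> > 0 \<and>
     (\<forall>t\<in>{0..<\<epsilon>}. C t \<in> direct_isometries) \<and>
     smooth_curve_on {0..<\<epsilon>} (\<lambda>t. (linear_part (C t), C t 0)) \<and>
     \<not> C constant_on {0..<\<epsilon>} \<and>
     C 0 = id \<and>
     (\<forall>t\<in>{0<..<\<epsilon>}. C t ` \<sigma> \<subseteq> \<tau>)"

end

theory Submission
  imports Defs
begin

text \<open>
  Let \<open>l\<^sub>a(x) = n\<^sub>a \<bullet> x + c\<^sub>a\<close> be the barycentric coordinates of \<open>\<tau>\<close>, \<open>P\<^sub>a\<close> the vertex of \<open>\<sigma>\<close> on
  the side opposite to \<open>a\<close>, \<open>G\<close> the centroid of \<open>\<tau>\<close> and \<open>J\<close> one of the two rotations by a right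
  angle. Consider the rigid motions
  \<open>C\<^sub>t(x) = G + cos t (x - G) + sin t (J x + w)\<close>.
  Since the \<open>n\<^sub>a\<close> sum to zero, \<open>w\<close> can be chosen such that \<open>n\<^sub>a \<bullet> (J P\<^sub>a + w)\<close> is the same number
  \<open>d\<close> for all \<open>a\<close>, and \<open>d \<ge> 0\<close> after possibly replacing \<open>J\<close> by \<open>-J\<close>. As \<open>l\<^sub>a(P\<^sub>a) = 0\<close> and \<open>l\<^sub>a(G) = 1/3\<close>, this gives
  \<open>l\<^sub>a(C\<^sub>t(P\<^sub>a)) = (1 - cos t)/3 + d sin t \<ge> 0\<close>, while the other coordinates of \<open>P\<^sub>a\<close> remain
  positive for small \<open>t\<close>.
\<close>

text \<open>Differentiating cos or sin shifts the argument by pi/2, which gives the k-th derivative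
  in closed form; the constant \<open>u\<close> survives only for k = 0.\<close>

lemma smooth_curve_on_cos_sin:
  fixes u v w :: "'a::real_normed_vector"
  shows "smooth_curve_on I (\<lambda>t. u + cos t *\<^sub>R v + sin t *\<^sub>R w)"
proof -
  define D where "D = (\<lambda>k t. (if k = 0 then u else 0)
    + cos (t + real k * (pi/2)) *\<^sub>R v + sin (t + real k * (pi/2)) *\<^sub>R w)"
  have "(D k has_vector_derivative D (Suc k) t) (at t within I)" for k t
  proof -
    have shift: "t + real (Suc k) * (pi/2) = (t + real k * (pi/2)) + pi/2"
      by (simp add: algebra_simps add_divide_distrib)
    have "D (Suc k) t = - sin (t + real k * (pi/2)) *\<^sub>R v + cos (t + real k * (pi/2)) *\<^sub>R w"
      unfolding D_def shift by (simp add: cos_add sin_add)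
    then show ?thesis
      unfolding D_def by (auto intro!: derivative_eq_intros)
  qed
  then show ?thesis
    unfolding smooth_curve_on_def by (intro exI[of _ D]) (auto simp: D_def)
qed

lemma rotation_matrix_2:
  assumes "x * x + y * y = (1::real)"
  shows "rotation_matrix (vector [vector [x, - y], vector [y, x]] :: real^2^2)"
  using assms unfolding rotation_matrix_def orthogonal_matrix_def
  by (simp add: det_2 vec_eq_iff forall_2 matrix_matrix_mult_def sum_2 transpose_def mat_def
      mult.commute add.commute)

text \<open>Subtracting a point \<open>b0\<close> of \<open>S\<close> other than \<open>a\<close>
  turns the remaining points into linearly independent vectors, on which a linear functional can be
  prescribed: 1 at \<open>a - b0\<close>, 0 at the others. The constant term then makes it vanish at
  \<open>b0\<close>.\<close>

lemma barycentric_functionals: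
  fixes S :: "'a::euclidean_space set"
  assumes "\<not> affine_dependent S" and "card S \<noteq> 1"
  obtains n c where "\<And>a b. a \<in> S \<Longrightarrow> b \<in> S \<Longrightarrow> n a \<bullet> b + c a = (if a = b then 1 else (0::real))"
proof -
  have "\<exists>v r. \<forall>b\<in>S. v \<bullet> b + r = (if a = b then 1 else (0::real))" if a: "a \<in> S" for a
  proof -
    from assms(2) a obtain b0 where b0: "b0 \<in> S" "b0 \<noteq> a"
      by (metis is_singletonI' is_singleton_altdef empty_iff)
    have "independent ((\<lambda>x. - b0 + x) ` (S - {b0}))"
      using affine_dependent_iff_dependent2[OF b0(1)] assms(1) by simp
    then obtain f where f: "linear f"
      "\<forall>x\<in>(\<lambda>x. - b0 + x) ` (S - {b0}). f x = (if x = a - b0 then 1 else (0::real))"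
      using linear_independent_extend[where f = "\<lambda>x. if x = a - b0 then 1 else 0"] by blast
    \<comment> \<open>The vector that represents the functional \<open>f\<close> by the inner
      product.\<close>
    define v where "v = adjoint f 1"
    have v: "f x = v \<bullet> x" for x
      using adjoint_works[OF f(1), of x 1] by (simp add: v_def inner_commute)
    have "v \<bullet> b + - (v \<bullet> b0) = (if a = b then 1 else 0)" if "b \<in> S" for b
    proof (cases "b = b0")
      case False
      then have "v \<bullet> (- b0 + b) = (if a = b then 1 else 0)"
        using f(2) v that by (auto simp: algebra_simps)
      then show ?thesis by (simp add: inner_diff_right split: if_splits)
    qed (use b0 in auto)
    then show ?thesis by blast
  qed
  then have "\<forall>a\<in>S. \<exists>p. \<forall>b\<in>S. fst p \<bullet> b + snd p = (if a = b then 1 else (0::real))"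
    by fastforce
  from bchoice[OF this] obtain p where
    "\<forall>a\<in>S. \<forall>b\<in>S. fst (p a) \<bullet> b + snd (p a) = (if a = b then 1 else (0::real))" ..
  then show ?thesis using that[of "fst \<circ> p" "snd \<circ> p"] by simp
qed

text \<open>Used for two kinds of weights: with sum 1 it recovers barycentric coordinates, with sum
  0 it yields a vector having prescribed inner products with the gradients.\<close>

lemma functional_affine_combination:
  fixes S :: "'a::euclidean_space set"
  assumes "finite S" and "a \<in> S"
    and delta: "\<And>b. b \<in> S \<Longrightarrow> v \<bullet> b + r = (if a = b then 1 else (0::real))"
  shows "v \<bullet> (\<Sum>b\<in>S. u b *\<^sub>R b) = u a - r * sum u S"
proof -
  have "v \<bullet> (\<Sum>b\<in>S. u b *\<^sub>R b) = (\<Sum>b\<in>S. u b * (v \<bullet> b))"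
    by (simp add: inner_sum_right)
  also have "\<dots> = (\<Sum>b\<in>S. (if a = b then u b else 0) - r * u b)"
  proof (rule sum.cong)
    fix b assume "b \<in> S"
    then have "v \<bullet> b = (if a = b then 1 else 0) - r" using delta[of b] by simp
    then show "u b * (v \<bullet> b) = (if a = b then u b else 0) - r * u b"
      by (simp only:) (simp add: algebra_simps)
  qed simp
  finally show ?thesis
    using assms(1,2) by (simp add: sum_subtractf sum_distrib_left)
qed

text \<open>Indexing the inscribed vertices by the opposite vertices of the outer triangle lets all
  three be treated alike.\<close>

lemma movement_of_inscribed_triangle:
  fixes S :: "(real^2) set" and P :: "real^2 \<Rightarrow> real^2"
  assumes indep: "\<not> affine_dependent S" and card: "card S = 3"
    and P: "\<And>a. a \<in> S \<Longrightarrow> P a \<in> rel_interior (convex hull (S - {a}))"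
  shows "\<exists>\<epsilon> C. movement \<epsilon> C (convex hull (P ` S)) (convex hull S)"
proof -
  have fin: "finite S" using card by (simp add: card_ge_0_finite)
  have "card S \<noteq> 1" using card by simp
  then obtain n c where delta:
    "\<And>a b. a \<in> S \<Longrightarrow> b \<in> S \<Longrightarrow> n a \<bullet> b + c a = (if a = b then 1 else (0::real))"
    using barycentric_functionals[OF indep] by blast
  define l where "l = (\<lambda>a x. n a \<bullet> x + c a)"
  have l_comb: "l a (\<Sum>b\<in>S. u b *\<^sub>R b) = u a" if "a \<in> S" "sum u S = 1" for a u
    unfolding l_def using functional_affine_combination[OF fin that(1) delta] that by simp
  have "aff_dim S = 2"
    using aff_dim_affine_independent[OF indep] card by simp
  then have "affine hull S = UNIV"
    using aff_dim_eq_full[of S] by simp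
  then have bary: "(\<Sum>a\<in>S. l a x) = 1 \<and> (\<Sum>a\<in>S. l a x *\<^sub>R a) = x" for x
  proof -
    have "x \<in> affine hull S" using \<open>affine hull S = UNIV\<close> by simp
    then obtain u where u: "sum u S = 1" "(\<Sum>b\<in>S. u b *\<^sub>R b) = x"
      unfolding affine_hull_finite[OF fin] by auto
    then have "l a x = u a" if "a \<in> S" for a using l_comb[OF that u(1)] by simp
    then show ?thesis using u by simp
  qed
  have in_hull: "x \<in> convex hull S" if "\<And>a. a \<in> S \<Longrightarrow> l a x \<ge> 0" for x
    unfolding convex_hull_finite[OF fin] using that bary[of x]
    by (intro CollectI exI[of _ "\<lambda>a. l a x"]) simp
  have lP: "l a (P a) = 0 \<and> (\<forall>b\<in>S - {a}. l b (P a) > 0)" if a: "a \<in> S" for a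
  proof -
    have "\<not> affine_dependent (S - {a})"
      using indep affine_dependent_subset by blast
    then obtain u where u: "\<forall>x\<in>S - {a}. 0 < u x" "sum u (S - {a}) = 1"
      "(\<Sum>x\<in>S - {a}. u x *\<^sub>R x) = P a"
      using P[OF a] unfolding rel_interior_convex_hull_explicit[OF \<open>\<not> affine_dependent (S - {a})\<close>]
      by auto
    \<comment> \<open>Weight 0 at \<open>a\<close> extends the positive weights on the opposite side
      to barycentric coordinates over all of \<open>S\<close>.\<close>
    define v where "v = u(a := 0)"
    have "sum v S = v a + sum v (S - {a})" and
      "(\<Sum>x\<in>S. v x *\<^sub>R x) = v a *\<^sub>R a + (\<Sum>x\<in>S - {a}. v x *\<^sub>R x)"
      by (rule sum.remove[OF fin a])+
    moreover have "sum v (S - {a}) = sum u (S - {a})"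
      "(\<Sum>x\<in>S - {a}. v x *\<^sub>R x) = (\<Sum>x\<in>S - {a}. u x *\<^sub>R x)"
      by (auto simp: v_def intro!: sum.cong)
    ultimately have 1: "sum v S = 1" and 2: "(\<Sum>x\<in>S. v x *\<^sub>R x) = P a"
      using u by (simp_all add: v_def)
    have "l b (P a) = v b" if "b \<in> S" for b using l_comb[OF that 1] 2 by simp
    then show ?thesis using u(1) a by (simp add: v_def)
  qed
  define e where "e = (\<Sum>a\<in>S. n a \<bullet> vector [- (P a)$2, (P a)$1])"
  \<comment> \<open>The sign chooses the sense of rotation for which the common speed
    \<open>d\<close> below is nonnegative.\<close>
  define s :: real where "s = (if e \<ge> 0 then 1 else - 1)"
  have s: "s * s = 1" "s * e \<ge> 0" by (auto simp: s_def)
  define J :: "real^2^2" where "J = vector [vector [0, - s], vector [s, 0]]"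
  have Jv: "J *v x = s *\<^sub>R vector [- x$2, x$1]" for x
    by (simp add: J_def vec_eq_iff forall_2 matrix_vector_mult_def sum_2)
  \<comment> \<open>The mean of the numbers \<open>n a \<bullet> (J *v P a)\<close>; exactly this
    value makes the coefficients in \<open>w\<close> sum to zero.\<close>
  define d where "d = s * e / 3"
  have d: "d \<ge> 0" using s by (simp add: d_def)
  define w where "w = (\<Sum>a\<in>S. (d - n a \<bullet> (J *v P a)) *\<^sub>R a)"
  have "(\<Sum>a\<in>S. d - n a \<bullet> (J *v P a)) = 0"
    by (simp add: sum_subtractf card Jv d_def e_def sum_distrib_left[symmetric])
  then have w: "n a \<bullet> (J *v P a + w) = d" if "a \<in> S" for a
    using functional_affine_combination[OF fin that delta, where u = "\<lambda>a. d - n a \<bullet> (J *v P a)"] that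
    by (simp add: inner_add_right w_def)
  define G where "G = (\<Sum>a\<in>S. (1/3) *\<^sub>R a)"
  have lG: "l a G = 1/3" if "a \<in> S" for a
    unfolding G_def using that card by (subst l_comb) auto
  define M where "M = (\<lambda>t. cos t *\<^sub>R mat 1 + sin t *\<^sub>R J)"
  define b where "b = (\<lambda>t. G + cos t *\<^sub>R (- G) + sin t *\<^sub>R w)"
  define C where "C = (\<lambda>t x. M t *v x + b t)"
  have C: "C t x = G + cos t *\<^sub>R (x - G) + sin t *\<^sub>R (J *v x + w)" for t x
    by (simp add: C_def M_def b_def matrix_vector_mult_add_rdistrib
        scaleR_matrix_vector_assoc[symmetric] scaleR_add_right scaleR_diff_right)
  have lC: "l a (C t x) = 1/3 + cos t * (l a x - 1/3) + sin t * (n a \<bullet> (J *v x + w))"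
    if "a \<in> S" for a t x
  proof -
    have "l a (C t x) = l a G + cos t * (l a x - l a G) + sin t * (n a \<bullet> (J *v x + w))"
      unfolding C l_def by (simp add: algebra_simps)
    then show ?thesis using lG[OF that] by simp
  qed
  have entries: "M t = vector [vector [cos t, - s * sin t], vector [s * sin t, cos t]]" for t
    by (simp add: M_def J_def vec_eq_iff forall_2 mat_def)
  have sc: "cos t * cos t + s * sin t * (s * sin t) = 1" for t
  proof -
    have "s * sin t * (s * sin t) = (s * s) * (sin t)\<^sup>2"
      by (simp add: power2_eq_square)
    also have "\<dots> = (sin t)\<^sup>2" by (simp only: s(1) mult_1)
    finally show ?thesis by (simp only: sin_cos_squared_add2 power2_eq_square[of "cos t", symmetric])
  qed
  have rot: "rotation_matrix (M t)" for t
    unfolding entries using rotation_matrix_2[OF sc[of t]] by simp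
  have lin: "linear_part (C t) = M t" for t by (simp add: C_def)
  \<comment> \<open>As t tends to 0 each of these coordinates tends to its value at
    \<open>P a\<close>, which is positive, and there are only finitely many pairs.\<close>
  have "eventually (\<lambda>t. \<forall>(a, a')\<in>S \<times> S. a \<noteq> a' \<longrightarrow> l a' (C t (P a)) > 0) (at_right 0)"
  proof (rule eventually_ball_finite)
    show "\<forall>p\<in>S \<times> S. \<forall>\<^sub>F t in at_right 0.
        case p of (a, a') \<Rightarrow> a \<noteq> a' \<longrightarrow> l a' (C t (P a)) > 0"
    proof clarify
      fix a a' assume a: "a \<in> S" "a' \<in> S"
      show "\<forall>\<^sub>F t in at_right 0. a \<noteq> a' \<longrightarrow> l a' (C t (P a)) > 0"
      proof (cases "a = a'")
        case False
        have "((\<lambda>t. l a' (C t (P a))) \<longlongrightarrow> 1/3 + cos 0 * (l a' (P a) - 1/3)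
            + sin 0 * (n a' \<bullet> (J *v P a + w))) (at_right 0)"
          unfolding lC[OF a(2)] by (intro tendsto_intros)
        then have "((\<lambda>t. l a' (C t (P a))) \<longlongrightarrow> l a' (P a)) (at_right 0)" by simp
        moreover have "l a' (P a) > 0" using lP[OF a(1)] a(2) False by auto
        ultimately show ?thesis by (auto dest: order_tendstoD(1) elim: eventually_mono)
      qed simp
    qed
  qed (use fin in simp)
  then obtain \<delta> where \<delta>0: "\<delta> > 0"
    and \<delta>1: "\<forall>t>0. t < \<delta> \<longrightarrow> (\<forall>(a, a')\<in>S \<times> S. a \<noteq> a' \<longrightarrow> l a' (C t (P a)) > 0)"
    unfolding eventually_at_right[OF zero_less_one] by blast
  have \<delta>: "l a' (C t (P a)) > 0"
    if "0 < t" "t < \<delta>" "a \<in> S" "a' \<in> S" "a \<noteq> a'" for t a a'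
    using \<delta>1[rule_format, OF that(1,2), of "(a, a')"] that(3-5) by simp
  \<comment> \<open>The bound pi keeps sin nonnegative and cos strictly decreasing; the latter shows
    that the curve is not constant.\<close>
  define \<epsilon> where "\<epsilon> = min \<delta> pi"
  have \<epsilon>: "\<epsilon> > 0" using \<delta>0 by (simp add: \<epsilon>_def)
  have CP: "C t (P a) \<in> convex hull S" if t: "t \<in> {0<..<\<epsilon>}" and a: "a \<in> S" for t a
  proof (rule in_hull)
    fix a' assume a': "a' \<in> S"
    show "l a' (C t (P a)) \<ge> 0"
    proof (cases "a = a'")
      case True
      have "l a (C t (P a)) = (1 - cos t)/3 + sin t * d"
        using lC[OF a, of t "P a"] lP[OF a] w[OF a] by (simp add: field_simps)
      moreover have "sin t \<ge> 0" using t by (intro sin_ge_zero) (auto simp: \<epsilon>_def)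
      ultimately show ?thesis using d True by simp
    next
      case False
      then show ?thesis using \<delta>[of t a a'] t a a' by (auto simp: \<epsilon>_def)
    qed
  qed
  have "movement \<epsilon> C (convex hull (P ` S)) (convex hull S)"
    unfolding movement_def
  proof (intro conjI ballI)
    show "\<epsilon> > 0" by (fact \<epsilon>)
    show "C t \<in> direct_isometries" for t
      unfolding direct_isometries_eq C_def using rot by blast
    \<comment> \<open>In the product of matrices and vectors the coordinates of the motion form a
      single cos-sin curve.\<close>
    have "(\<lambda>t. (linear_part (C t), C t 0))
        = (\<lambda>t. (0, G) + cos t *\<^sub>R (mat 1, - G) + sin t *\<^sub>R (J, w))"
      by (intro ext) (simp add: lin, simp add: M_def C_def b_def)
    then show "smooth_curve_on {0..<\<epsilon>} (\<lambda>t. (linear_part (C t), C t 0))"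
      by (simp only: smooth_curve_on_cos_sin)
    show "\<not> C constant_on {0..<\<epsilon>}"
    proof
      assume "C constant_on {0..<\<epsilon>}"
      then have "C (\<epsilon>/2) = C 0" using \<epsilon> by (auto simp: constant_on_def)
      then have "M (\<epsilon>/2) = M 0" using lin[of "\<epsilon>/2"] lin[of 0] by simp
      then have "M (\<epsilon>/2) $ 1 $ 1 = M 0 $ 1 $ 1" by simp
      then have "cos (\<epsilon>/2) = cos 0" by (simp add: entries)
      moreover have "cos (\<epsilon>/2) < cos 0"
        using \<epsilon> by (intro cos_monotone_0_pi) (auto simp: \<epsilon>_def min_def)
      ultimately show False by simp
    qed
    show "C 0 = id" by (auto simp: C)
    fix t assume t: "t \<in> {0<..<\<epsilon>}"
    \<comment> \<open>Affine maps commute with convex hulls, so it suffices to control the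
      vertices.\<close>
    have "C t ` (convex hull (P ` S)) = convex hull (C t ` P ` S)"
    proof -
      have "C t ` X = (\<lambda>x. b t + x) ` (*v) (M t) ` X" for X
        by (auto simp: C_def image_image add.commute)
      then show ?thesis
        by (simp add: convex_hull_translation convex_hull_linear_image matrix_vector_mul_linear)
    qed
    also have "\<dots> \<subseteq> convex hull S"
      using CP[OF t] by (intro hull_minimal) auto
    finally show "C t ` (convex hull (P ` S)) \<subseteq> convex hull S" .
  qed
  then show ?thesis by blast
qed

text \<open>A face of a simplex is spanned by some of its vertices, and dimension 1 leaves exactly
  two of the three.\<close>

lemma edge_of_triangle:
  assumes indep: "\<not> affine_dependent S" and "card S = 3" and "s edge_of (convex hull S)"
  obtains a where "a \<in> S" "s = convex hull (S - {a})"
proof -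
  obtain T where T: "T \<subseteq> S" "s = convex hull T"
    using assms(3) face_of_convex_hull_affine_independent[OF indep] unfolding edge_of_def by blast
  have "\<not> affine_dependent T" using indep T(1) affine_dependent_subset by blast
  then have "int (card T) - 1 = 1"
    using assms(3) T(2) aff_dim_affine_independent[of T] by (simp add: edge_of_def aff_dim_convex_hull)
  moreover have "finite S" using assms(2) by (simp add: card_ge_0_finite)
  ultimately have "card (S - T) = 1"
    using T(1) assms(2) by (simp add: card_Diff_subset finite_subset)
  then obtain a where "S - T = {a}" by (auto simp: card_1_singleton_iff)
  then have "a \<in> S" "T = S - {a}" using T(1) by auto
  then show ?thesis using that T(2) by blast
qed

text \<open>\<open>2 simplex\<close> only provides some affinely independent spanning triple. Affine
  dimension 2 forces the given points to be such a triple.\<close>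

lemma two_simplex_vertices:
  assumes "2 simplex (convex hull {A0, A1, A2})"
  shows "\<not> affine_dependent {A0, A1, A2}" and "card {A0, A1, A2} = 3"
proof -
  let ?S = "{A0, A1, A2}"
  have dim: "aff_dim ?S = 2"
    using aff_dim_simplex[OF assms] by (simp add: aff_dim_convex_hull)
  have "card ?S \<le> 3" by (simp add: card_insert_if)
  moreover have "aff_dim ?S \<le> int (card ?S) - 1"
    by (intro aff_dim_le_card) simp
  ultimately show card: "card ?S = 3" using dim by simp
  show "\<not> affine_dependent ?S"
    unfolding affine_independent_iff_card using dim card by simp
qed

theorem proposition2:
  fixes P0 P1 P2 A0 A1 A2 :: "real^2" and \<sigma> \<tau> :: "(real^2) set"
  assumes "\<sigma> = convex hull {P0, P1, P2}" and "2 simplex \<sigma>"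
    and "\<tau> = convex hull {A0, A1, A2}" and "2 simplex \<tau>"
    and "\<sigma> \<subseteq> \<tau>"
    and "\<exists>s0 s1 s2. s0 edge_of \<tau> \<and> s1 edge_of \<tau> \<and> s2 edge_of \<tau> \<and> distinct [s0, s1, s2] \<and>
           P0 \<in> rel_interior s0 \<and> P1 \<in> rel_interior s1 \<and> P2 \<in> rel_interior s2"
  shows "\<exists>\<epsilon> C. movement \<epsilon> C \<sigma> \<tau>"
proof -
  define S where "S = {A0, A1, A2}"
  have \<tau>: "\<tau> = convex hull S" using assms(3) by (simp add: S_def)
  have indep: "\<not> affine_dependent S" and card: "card S = 3"
    using two_simplex_vertices assms(3,4) by (simp_all add: S_def)
  from assms(6) obtain s0 s1 s2 where
    edges: "s0 edge_of \<tau>" "s1 edge_of \<tau>" "s2 edge_of \<tau>" "distinct [s0, s1, s2]" and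
    P: "P0 \<in> rel_interior s0" "P1 \<in> rel_interior s1" "P2 \<in> rel_interior s2"
    by blast
  note edge = edge_of_triangle[OF indep card]
  obtain B0 where B0: "B0 \<in> S" "s0 = convex hull (S - {B0})"
    using edge edges(1) \<tau> by blast
  obtain B1 where B1: "B1 \<in> S" "s1 = convex hull (S - {B1})"
    using edge edges(2) \<tau> by blast
  obtain B2 where B2: "B2 \<in> S" "s2 = convex hull (S - {B2})"
    using edge edges(3) \<tau> by blast
  \<comment> \<open>Different edges omit different vertices, so the omitted vertices exhaust
    \<open>S\<close>.\<close>
  have ne: "B0 \<noteq> B1" "B0 \<noteq> B2" "B1 \<noteq> B2" using edges(4) B0 B1 B2 by auto
  have "{B0, B1, B2} = S"
    using B0(1) B1(1) B2(1) ne card by (intro card_subset_eq) (auto simp: card_ge_0_finite)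
  \<comment> \<open>Each vertex of \<open>\<sigma>\<close> is labelled by the vertex of
    \<open>\<tau>\<close> opposite to its side.\<close>
  define Q where "Q = (\<lambda>a. if a = B0 then P0 else if a = B1 then P1 else P2)"
  have "Q a \<in> rel_interior (convex hull (S - {a}))" if "a \<in> S" for a
    using that P B0 B1 B2 \<open>{B0, B1, B2} = S\<close> by (auto simp: Q_def)
  then have "\<exists>\<epsilon> C. movement \<epsilon> C (convex hull (Q ` S)) (convex hull S)"
    by (rule movement_of_inscribed_triangle[OF indep card])
  moreover have "Q ` S = {P0, P1, P2}"
    using ne unfolding \<open>{B0, B1, B2} = S\<close>[symmetric] by (auto simp: Q_def)
  ultimately show ?thesis using assms(1) \<tau> by simp
qed

end
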